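(* Let $n,m,k\ge 1$, let $\mathbf{a}_d(\cdot,k-1):\mathbb{R}^n\to\mathbb{R}^n$ and $\mathbf{c}_d(\cdot,k):\mathbb{R}^n\to\mathbb{R}^m$ be polynomial maps (of degree at most $d$), and consider the measurement equation $\mathbf{y}(k)=\mathbf{c}_d(\mathbf{x}(k),k)+\mathbf{v}(k)$, where the only information on the measurement noise is $\mathbf{v}(k)\in\mathcal{V}_k$, with $\mathcal{V}_k\subset\mathbb{R}^m$ a compact basic semialgebraic set. Let $\mathcal{X}_{k-1}\subset\mathbb{R}^n$ be a Borel set, $\mathcal{W}_{k-1}\subset\mathbb{R}^n$ a compact basic semialgebraic set, and $$\hat{\mathcal{X}}_k=\{\mathbf{a}_d(\mathbf{x},k-1)+\mathbf{w}:\ \mathbf{x}\in\mathcal{X}_{k-1},\ \mathbf{w}\in\mathcal{W}_{k-1}\},$$ which is assumed to be a Borel set. Assume that, before observing $\mathbf{y}(k)$, the only probabilistic knowledge about $\mathbf{x}(k)$ is its support $\hat{\mathcal{X}}_k$, i.e. its set of probability measures is $\hat{\mathcal{P}}_{\hat{\mathcal{X}}_k}(\mathbf{X}(k))\equiv\mathrm{Co}\{\delta_{\hat{\mathbf{x}}}:\hat{\mathbf{x}}\in\hat{\mathcal{X}}_k\}$. Then, given the observed value $\mathbf{y}(k)$, the updated probability measure of the state $\mathbf{x}(k)$ belongs to a set $\mathcal{P}_{\mathcal{X}_k}(\mathbf{X}(k))$ (the updated set, obtained by applying Bayes' rule element-wise as described in the context) satisfying $$\mathcal{P}_{\mathcal{X}_k}(\mathbf{X}(k))\equiv\mathrm{Co}\{\delta_{\hat{\mathbf{x}}}:\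 \hat{\mathbf{x}}\in\mathcal{X}_k\},$$ where $\mathcal{X}_k=\hat{\mathcal{X}}_k\cap\mathcal{Y}_k$ and $\mathcal{Y}_k=\{\mathbf{x}\in\mathbb{R}^n:\ \mathbf{y}(k)-\mathbf{c}_d(\mathbf{x},k)\in\mathcal{V}_k\}$.
   Context: A basic semialgebraic set is a set defined by finitely many polynomial inequalities. $\delta_{\mathbf{x}}$ is the Dirac (atomic) measure at $\mathbf{x}$, and $\mathrm{Co}$ denotes convex hull. For two sets $\mathcal{A},\mathcal{B}$ of Borel probability measures on $\mathbb{R}^n$, $\mathcal{A}\equiv\mathcal{B}$ means that they are equivalent in terms of inferences (expectations): for every bounded Borel function $g:\mathbb{R}^n\to\mathbb{R}$, $\sup_{P\in\mathcal{A}}\int g\,dP=\sup_{P\in\mathcal{B}}\int g\,dP$ (and hence the same for infima, replacing $g$ by $-g$). The prior set $\hat{\mathcal{P}}_{\hat{\mathcal{X}}_k}(\mathbf{X}(k))$ is the set of all Borel probability measures $Q$ on $\mathbb{R}^n$ with $Q(\hat{\mathcal{X}}_k)=1$. Updated set: the information $\mathbf{v}(k)\in\mathcal{V}_k$ means that, given $\mathbf{x}(k)=\mathbf{x}$, the conditional probability measure of $\mathbf{Y}(k)$ may be any Borel probability measure concentrated on $\mathbf{c}_d(\mathbf{x},k)+\mathcal{V}_k$. For a Markov kernel $L$ from $\mathbb{R}^n$ to $\mathbb{R}^m$ with $L(\mathbf{x},\mathbf{c}_d(\mathbf{x},k)+\mathcal{V}_k)=1$ for every $\mathbf{x}\in\mathbb{R}^n$,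 and for $Q$ in the prior set, Bayes' rule gives the measure $$A\mapsto \frac{\int_A L(\mathbf{x},\{\mathbf{y}(k)\})\,dQ(\mathbf{x})}{\int_{\mathbb{R}^n} L(\mathbf{x},\{\mathbf{y}(k)\})\,dQ(\mathbf{x})},$$ and it is applied only to those pairs $(L,Q)$ for which the denominator is strictly positive (the "regular extension" way of updating sets of probability measures). The updated set $\mathcal{P}_{\mathcal{X}_k}(\mathbf{X}(k))$ is the set of all measures so obtained. *)

theory Defs
  imports "HOL-Probability.Probability"
begin

definition real_poly_deg_le :: "nat \<Rightarrow> (real^'n \<Rightarrow> real) \<Rightarrow> bool" where
  "real_poly_deg_le d p \<longleftrightarrow>
     (\<exists>q :: ('n \<Rightarrow> nat) \<Rightarrow> real.
        \<forall>x. p x = (\<Sum>\<alpha> | (\<Sum>i\<in>UNIV. \<alpha> i) \<le> d. q \<alpha> * (\<Prod>i\<in>UNIV. (x $ i) ^ \<alpha> i)))"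

definition poly_map_deg_le :: "nat \<Rightarrow> (real^'n \<Rightarrow> real^'m) \<Rightarrow> bool" where
  "poly_map_deg_le d f \<longleftrightarrow> (\<forall>j. real_poly_deg_le d (\<lambda>x. f x $ j))"

text \<open>There are finitely many multi-indices of total degree at most \<open>d\<close>, so the sum above is not the
  default value of a sum over an infinite set.\<close>

lemma finite_multi_indices: "finite {\<alpha> :: 'n::finite \<Rightarrow> nat. (\<Sum>i\<in>UNIV. \<alpha> i) \<le> d}"
proof (rule finite_subset)
  show "{\<alpha> :: 'n \<Rightarrow> nat. (\<Sum>i\<in>UNIV. \<alpha> i) \<le> d} \<subseteq> PiE UNIV (\<lambda>_. {..d})"
  proof
    fix \<alpha> :: "'n \<Rightarrow> nat"
    assume *: "\<alpha> \<in> {\<alpha>. (\<Sum>i\<in>UNIV. \<alpha> i) \<le> d}"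
    have "\<alpha> i \<le> d" for i
      using * member_le_sum[of i UNIV \<alpha>] by (auto intro: order_trans)
    then show "\<alpha> \<in> PiE UNIV (\<lambda>_. {..d})" by auto
  qed
qed (auto intro: finite_PiE)

lemma real_poly_deg_le_imp_real_polynomial_function:
  fixes p :: "real^'n \<Rightarrow> real"
  assumes "real_poly_deg_le d p"
  shows "real_polynomial_function p"
proof -
  obtain q :: "('n \<Rightarrow> nat) \<Rightarrow> real" where
    q: "p = (\<lambda>x. \<Sum>\<alpha> | (\<Sum>i\<in>UNIV. \<alpha> i) \<le> d. q \<alpha> * (\<Prod>i\<in>UNIV. (x $ i) ^ \<alpha> i))"
    using assms unfolding real_poly_deg_le_def by auto
  have "real_polynomial_function (\<lambda>x :: real^'n. x $ i)" for i
    by (intro real_polynomial_function.intros(1) bounded_linear_vec_nth)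
  then show ?thesis
    unfolding q
    by (intro real_polynomial_function_sum real_polynomial_function.intros(2,4)
        real_polynomial_function_prod
        real_polynomial_function_power finite_multi_indices) auto
qed

text \<open>Both strict and non-strict inequalities are allowed; equations are pairs of
  non-strict inequalities.\<close>

definition basic_semialgebraic :: "(real^'n) set \<Rightarrow> bool" where
  "basic_semialgebraic S \<longleftrightarrow>
     (\<exists>G H. finite G \<and> finite H \<and> (\<forall>g\<in>G \<union> H. real_polynomial_function g) \<and>
        S = {x. (\<forall>g\<in>G. g x \<le> 0) \<and> (\<forall>h\<in>H. h x < 0)})"

text \<open>The convex hull of a set of Borel measures.  Measures are not a real vector space in
  HOL, so finite convex combinations are taken setwise.\<close>

definition measure_convex_hull ::
    "'a::topological_space measure set \<Rightarrow> 'a measure set" where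
  "measure_convex_hull S =
     {M. sets M = sets borel \<and>
         (\<exists>T w. finite T \<and> T \<subseteq> S \<and> (\<forall>P\<in>T. 0 \<le> w P) \<and> (\<Sum>P\<in>T. w P) = (1::real) \<and>
            (\<forall>A\<in>sets borel. emeasure M A = (\<Sum>P\<in>T. ennreal (w P) * emeasure P A)))}"

text \<open>Suprema are taken in \<^typ>\<open>ereal\<close>, so that the supremum over the empty set is
  \<open>-\<infinity>\<close>: an empty set of measures is equivalent only to the empty set.\<close>

definition inference_equiv ::
    "'a::topological_space measure set \<Rightarrow> 'a measure set \<Rightarrow> bool" where
  "inference_equiv \<A> \<B> \<longleftrightarrow>
     (\<forall>g :: 'a \<Rightarrow> real. g \<in> borel_measurable borel \<and> bounded (range g) \<longrightarrow>
        (SUP P\<in>\<A>. ereal (integral\<^sup>L P g)) = (SUP P\<in>\<B>. ereal (integral\<^sup>L P g)))"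

definition prior_set :: "'a::topological_space set \<Rightarrow> 'a measure set" where
  "prior_set X = {Q. sets Q = sets borel \<and> prob_space Q \<and> emeasure Q X = 1}"

definition noise_kernels ::
    "('a::topological_space \<Rightarrow> 'b::real_normed_vector) \<Rightarrow> 'b set \<Rightarrow> ('a \<Rightarrow> 'b measure) set" where
  "noise_kernels c V =
     {L \<in> borel \<rightarrow>\<^sub>M prob_algebra borel. \<forall>x. emeasure (L x) ((\<lambda>v. c x + v) ` V) = 1}"

definition bayes_update ::
    "('a::topological_space \<Rightarrow> 'b::topological_space measure) \<Rightarrow> 'a measure \<Rightarrow> 'b \<Rightarrow> 'a measure" where
  "bayes_update L Q y =
     measure_of UNIV (sets borel)
       (\<lambda>A. (\<integral>\<^sup>+x\<in>A. emeasure (L x) {y} \<partial>Q) / (\<integral>\<^sup>+x. emeasure (L x) {y} \<partial>Q))"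

definition updated_set ::
    "('a::topological_space \<Rightarrow> 'b::real_normed_vector) \<Rightarrow> 'b set \<Rightarrow> 'a set \<Rightarrow> 'b \<Rightarrow> 'a measure set" where
  "updated_set c V X y =
     {bayes_update L Q y | L Q.
        L \<in> noise_kernels c V \<and> Q \<in> prior_set X \<and> 0 < (\<integral>\<^sup>+x. emeasure (L x) {y} \<partial>Q)}"

definition predicted_support :: "('a \<Rightarrow> 'a::plus) \<Rightarrow> 'a set \<Rightarrow> 'a set \<Rightarrow> 'a set" where
  "predicted_support a X W = {a x + w | x w. x \<in> X \<and> w \<in> W}"

definition measurement_set :: "('a \<Rightarrow> 'b::minus) \<Rightarrow> 'b set \<Rightarrow> 'b \<Rightarrow> 'a set" where
  "measurement_set c V y = {x. y - c x \<in> V}"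

text \<open>\<^const>\<open>measure_of\<close> yields the null measure when its argument is not a measure; this
  does not happen here.\<close>

lemma
  fixes L :: "'a::topological_space \<Rightarrow> 'b::t1_space measure"
  assumes L: "L \<in> borel \<rightarrow>\<^sub>M prob_algebra borel" and Q: "sets Q = sets borel"
  shows sets_bayes_update: "sets (bayes_update L Q y) = sets borel"
    and emeasure_bayes_update: "A \<in> sets borel \<Longrightarrow> emeasure (bayes_update L Q y) A =
          (\<integral>\<^sup>+x\<in>A. emeasure (L x) {y} \<partial>Q) / (\<integral>\<^sup>+x. emeasure (L x) {y} \<partial>Q)"
proof -
  define f where "f x = emeasure (L x) {y}" for x
  define Z where "Z = (\<integral>\<^sup>+x. f x \<partial>Q)"
  have "f \<in> borel_measurable borel"
    unfolding f_def
    by (rule measurable_emeasure_kernel[OF measurable_prob_algebraD[OF L]]) auto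
  then have f: "f \<in> borel_measurable Q"
    using Q measurable_cong_sets by blast
  have dens: "emeasure (density Q (\<lambda>x. f x / Z)) A = (\<integral>\<^sup>+x\<in>A. f x \<partial>Q) / Z"
    if "A \<in> sets borel" for A
  proof -
    have A: "A \<in> sets Q" using that Q by simp
    have "emeasure (density Q (\<lambda>x. f x / Z)) A = (\<integral>\<^sup>+x. f x / Z * indicator A x \<partial>Q)"
      using f A by (intro emeasure_density) auto
    also have "\<dots> = (\<integral>\<^sup>+x. (f x * indicator A x) / Z \<partial>Q)"
      by (simp add: divide_ennreal_def mult_ac)
    also have "\<dots> = (\<integral>\<^sup>+x. f x * indicator A x \<partial>Q) / Z"
      using f A by (intro nn_integral_divide) auto
    finally show ?thesis .
  qed
  have eq: "bayes_update L Q y = density Q (\<lambda>x. f x / Z)"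
  proof -
    have sp: "space Q = UNIV" using sets_eq_imp_space_eq[OF Q] by simp
    have "density Q (\<lambda>x. f x / Z) =
        measure_of UNIV (sets borel) (emeasure (density Q (\<lambda>x. f x / Z)))"
      using measure_of_of_measure[of "density Q (\<lambda>x. f x / Z)"] Q sp by simp
    also have "\<dots> = bayes_update L Q y"
      unfolding bayes_update_def
    proof (rule measure_of_eq)
      show "sets borel \<subseteq> Pow (UNIV :: 'a set)" by simp
    next
      fix A :: "'a set"
      assume "A \<in> sigma_sets UNIV (sets borel)"
      then have "A \<in> sets borel"
        using sets.sigma_sets_eq[of "borel :: 'a measure"] by simp
      then show "emeasure (density Q (\<lambda>x. f x / Z)) A =
          (\<integral>\<^sup>+x\<in>A. emeasure (L x) {y} \<partial>Q) / (\<integral>\<^sup>+x. emeasure (L x) {y} \<partial>Q)"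
        using dens by (simp add: f_def Z_def)
    qed
    finally show ?thesis ..
  qed
  show "sets (bayes_update L Q y) = sets borel" using Q by (simp add: eq)
  show "emeasure (bayes_update L Q y) A =
      (\<integral>\<^sup>+x\<in>A. emeasure (L x) {y} \<partial>Q) / (\<integral>\<^sup>+x. emeasure (L x) {y} \<partial>Q)"
    if "A \<in> sets borel"
    using dens[OF that] by (simp add: eq f_def Z_def)
qed

text \<open>The prior satisfies the equivalence with the convex hull of the Dirac measures on the
  support, so this is not a separate hypothesis on it.\<close>

lemma SUP_integral_supported:
  fixes g :: "'a::topological_space \<Rightarrow> real"
  assumes g: "g \<in> borel_measurable borel" "bounded (range g)"
    and S: "\<And>P. P \<in> S \<Longrightarrow> sets P = sets borel \<and> prob_space P \<and> (AE x in P. x \<in> X)"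
    and dirac: "\<And>x. x \<in> X \<Longrightarrow> return borel x \<in> S"
  shows "(SUP P\<in>S. ereal (integral\<^sup>L P g)) = (SUP x\<in>X. ereal (g x))"
proof (rule antisym)
  show "(SUP P\<in>S. ereal (integral\<^sup>L P g)) \<le> (SUP x\<in>X. ereal (g x))"
  proof (rule SUP_least)
    fix P assume "P \<in> S"
    then have P: "sets P = sets borel" "prob_space P" "AE x in P. x \<in> X" using S by auto
    interpret prob_space P by fact
    obtain B where B: "\<And>x. \<bar>g x\<bar> \<le> B" using g(2) by (auto simp: bounded_iff)
    have gP: "g \<in> borel_measurable P" using g(1) P(1) measurable_cong_sets by blast
    have int: "integrable P g" using B gP by (intro integrable_const_bound[of g B]) auto
    have "X \<noteq> {}" using P(3) AE_False by auto
    then obtain x0 where "x0 \<in> X" by blast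
    have "ereal (g x0) \<le> (SUP x\<in>X. ereal (g x))" using \<open>x0 \<in> X\<close> by (rule SUP_upper)
    moreover have "(SUP x\<in>X. ereal (g x)) \<le> ereal B"
      using B by (intro SUP_least) (auto simp: abs_le_iff)
    ultimately obtain r where r: "(SUP x\<in>X. ereal (g x)) = ereal r"
      by (cases "SUP x\<in>X. ereal (g x)") auto
    have "g x \<le> r" if "x \<in> X" for x
      using SUP_upper[OF that, of "\<lambda>x. ereal (g x)"] by (simp add: r)
    then have "integral\<^sup>L P g \<le> r"
      using P(3) by (intro integral_le_const int) (auto elim!: eventually_mono)
    then show "ereal (integral\<^sup>L P g) \<le> (SUP x\<in>X. ereal (g x))" by (simp add: r)
  qed
  show "(SUP x\<in>X. ereal (g x)) \<le> (SUP P\<in>S. ereal (integral\<^sup>L P g))"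
  proof (rule SUP_least)
    fix x assume "x \<in> X"
    then have "ereal (integral\<^sup>L (return borel x) g) \<le> (SUP P\<in>S. ereal (integral\<^sup>L P g))"
      by (intro SUP_upper dirac)
    then show "ereal (g x) \<le> (SUP P\<in>S. ereal (integral\<^sup>L P g))"
      using g(1) by (simp add: integral_return)
  qed
qed

lemma prior_set_equiv:
  fixes X :: "'a::topological_space set"
  assumes X: "X \<in> sets borel"
  shows "inference_equiv (prior_set X) (measure_convex_hull ((\<lambda>x. return borel x) ` X))"
proof -
  have prob: "sets P = sets borel \<and> prob_space P \<and> (AE x in P. x \<in> X)"
    if "sets P = sets borel" "emeasure P X = 1" "emeasure P UNIV = 1" for P :: "'a measure"
  proof -
    have sp: "space P = UNIV" using sets_eq_imp_space_eq[OF that(1)] by simp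
    interpret prob_space P by standard (simp add: sp that)
    have "AE x in P. x \<in> X"
      using that X by (intro AE_in_set_eq_1[THEN iffD2]) (auto simp: measure_def)
    then show ?thesis using that prob_space_axioms by simp
  qed
  have 1: "sets P = sets borel \<and> prob_space P \<and> (AE x in P. x \<in> X)" if "P \<in> prior_set X" for P
    using that prob[of P] prob_space.emeasure_space_1[of P] sets_eq_imp_space_eq[of P borel]
    by (auto simp: prior_set_def)
  have 2: "return borel x \<in> prior_set X" if "x \<in> X" for x
    using that X by (auto simp: prior_set_def intro!: prob_space_return)
  have 3: "sets P = sets borel \<and> prob_space P \<and> (AE x in P. x \<in> X)"
    if "P \<in> measure_convex_hull ((\<lambda>x. return borel x) ` X)" for P
  proof -
    from that obtain T w where T: "T \<subseteq> (\<lambda>x. return borel x) ` X" "\<forall>P\<in>T. 0 \<le> w P"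
        "(\<Sum>P\<in>T. w P) = (1::real)" "sets P = sets borel"
        "\<And>A. A \<in> sets borel \<Longrightarrow> emeasure P A = (\<Sum>P\<in>T. ennreal (w P) * emeasure P A)"
      unfolding measure_convex_hull_def by blast
    have "emeasure P A = 1" if A: "A \<in> sets borel" "X \<subseteq> A" for A
    proof -
      have "emeasure P A = (\<Sum>P\<in>T. ennreal (w P))"
        unfolding T(5)[OF A(1)]
      proof (rule sum.cong)
        fix R assume "R \<in> T"
        then obtain x where "x \<in> X" "R = return borel x" using T(1) by blast
        then show "ennreal (w R) * emeasure R A = ennreal (w R)" using A by auto
      qed simp
      also have "\<dots> = 1" using T(2,3) by (simp add: sum_ennreal)
      finally show ?thesis .
    qed
    then show ?thesis using X T(4) by (intro prob) auto
  qed
  have 4: "return borel x \<in> measure_convex_hull ((\<lambda>x. return borel x) ` X)" if "x \<in> X" for x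
    unfolding measure_convex_hull_def
    using that by (auto intro!: exI[of _ "{return borel x}"] exI[of _ "\<lambda>_. 1"])
  show ?thesis
    unfolding inference_equiv_def
    using SUP_integral_supported[OF _ _ 1 2] SUP_integral_supported[OF _ _ 3 4] by auto
qed

end

theory Submission
  imports Defs
begin

text \<open>Bayes' rule multiplies \<open>Q\<close> by the likelihood \<open>L x {y}\<close>, which vanishes unless \<open>y - c x \<in> V\<close>;
  so every updated measure lives on the intersection.  Conversely, for \<open>x\<^sub>0\<close> in the intersection, a
  deterministic kernel that puts its mass at \<open>y\<close> wherever the noise constraint permits leaves the
  Dirac prior at \<open>x\<^sub>0\<close> unchanged.  Expectations over both sets thus have as supremum that of the
  integrand over the intersection.\<close>

lemma prior_setD:
  assumes "Q \<in> prior_set X" "X \<in> sets borel"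
  shows "sets Q = sets borel" "prob_space Q" "AE x in Q. x \<in> X"
proof -
  show Q: "sets Q = sets borel" "prob_space Q"
    using assms by (auto simp: prior_set_def)
  interpret prob_space Q by fact
  show "AE x in Q. x \<in> X"
    using assms Q by (intro AE_in_set_eq_1[THEN iffD2]) (auto simp: prior_set_def measure_def)
qed

text \<open>The translate \<open>c x + V\<close> already carries all the mass of \<open>L x\<close>,
  and \<open>y\<close> lies outside it. An atom at \<open>y\<close> would be disjoint from the
  translate and push the total mass above 1.\<close>

lemma noise_kernels_atom_eq_0:
  fixes c :: "'a::topological_space \<Rightarrow> 'b::real_normed_vector"
  assumes L: "L \<in> noise_kernels c V" and x: "x \<notin> measurement_set c V y"
  shows "emeasure (L x) {y} = 0"
proof -
  have "L x \<in> space (prob_algebra borel)"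
    using L by (auto simp: noise_kernels_def intro: measurable_space)
  then have P: "prob_space (L x)" and s: "sets (L x) = sets borel"
    by (auto simp: space_prob_algebra)
  interpret prob_space "L x" by (rule P)
  let ?S = "(\<lambda>v. c x + v) ` V"
  have S1: "emeasure (L x) ?S = 1" using L by (simp add: noise_kernels_def)
  \<comment> \<open>Measurability of the translate is read off from its mass:
    \<open>emeasure\<close> takes the value 0 on non-measurable sets, and here it is 1.\<close>
  then have S: "?S \<in> sets (L x)" using emeasure_notin_sets by fastforce
  have y: "{y} \<in> sets (L x)" by (simp add: s)
  have "y \<notin> ?S" using x by (auto simp: measurement_set_def)
  then have "emeasure (L x) (insert y ?S) = emeasure (L x) {y} + 1"
    using plus_emeasure[OF y S] S1 by simp
  moreover have "emeasure (L x) (insert y ?S) \<le> 1"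
    by (rule emeasure_le_1)
  ultimately have "1 + emeasure (L x) {y} \<le> 1 + 0" by (simp add: add.commute)
  then show ?thesis by (subst (asm) ennreal_add_left_cancel_le) auto
qed

lemma updated_set_subset_prior_set:
  fixes c :: "'a::topological_space \<Rightarrow> 'b::real_normed_vector"
  assumes X: "X \<in> sets borel" and Y: "measurement_set c V y \<in> sets borel"
  shows "updated_set c V X y \<subseteq> prior_set (X \<inter> measurement_set c V y)"
proof
  fix P assume "P \<in> updated_set c V X y"
  then obtain L Q where P: "P = bayes_update L Q y" and L: "L \<in> noise_kernels c V"
    and Q: "Q \<in> prior_set X" and pos: "0 < (\<integral>\<^sup>+x. emeasure (L x) {y} \<partial>Q)"
    by (auto simp: updated_set_def)
  note Q' = prior_setD[OF Q X]
  have Lm: "L \<in> borel \<rightarrow>\<^sub>M prob_algebra borel" using L by (simp add: noise_kernels_def)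
  interpret Q: prob_space Q by (rule Q'(2))
  define Z where "Z = (\<integral>\<^sup>+x. emeasure (L x) {y} \<partial>Q)"
  have "emeasure (L x) {y} \<le> 1" for x
  proof -
    have "L x \<in> space (prob_algebra borel)" using Lm by (auto intro: measurable_space)
    then have "prob_space (L x)" by (auto simp: space_prob_algebra)
    then show ?thesis by (rule prob_space.emeasure_le_1)
  qed
  then have "Z \<le> (\<integral>\<^sup>+x. 1 \<partial>Q)" unfolding Z_def by (intro nn_integral_mono)
  then have "Z \<le> 1" by (simp add: Q.emeasure_space_1)
  \<comment> \<open>In \<open>ennreal\<close> the quotient \<open>Z / Z\<close> is 1 only for
    positive finite \<open>Z\<close>. Regular extension supplies positivity, and the bound of the
    likelihood by 1 supplies finiteness.\<close>
  then have Zdiv: "Z / Z = 1"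
    using pos by (intro ennreal_divide_self) (auto simp: Z_def intro: le_less_trans)
  \<comment> \<open>Stated for every Borel superset of the intersection so that it serves twice:
    \<open>UNIV\<close> gives total mass 1, the intersection itself gives the support.\<close>
  have P_eq_1: "emeasure P A = 1" if A: "A \<in> sets borel" "X \<inter> measurement_set c V y \<subseteq> A" for A
  proof -
    have "(\<integral>\<^sup>+x\<in>A. emeasure (L x) {y} \<partial>Q) = Z"
      unfolding Z_def using Q'(3)
    proof (intro nn_integral_cong_AE, elim eventually_mono)
      \<comment> \<open>The indicator loses no mass: a point of \<open>X\<close> outside
        \<open>A\<close> is outside the measurement set, where the likelihood vanishes.\<close>
      fix x assume "x \<in> X"
      then show "emeasure (L x) {y} * indicator A x = emeasure (L x) {y}"
        using A(2) noise_kernels_atom_eq_0[OF L, of x y] by (auto simp: indicator_def)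
    qed
    then show ?thesis
      using emeasure_bayes_update[OF Lm Q'(1) A(1)] Zdiv by (simp add: P Z_def)
  qed
  have sets_P: "sets P = sets borel" unfolding P by (rule sets_bayes_update[OF Lm Q'(1)])
  moreover have "prob_space P"
    using P_eq_1[of UNIV] sets_eq_imp_space_eq[OF sets_P] by (intro prob_spaceI) simp
  moreover have "emeasure P (X \<inter> measurement_set c V y) = 1"
    using X Y by (intro P_eq_1) auto
  ultimately show "P \<in> prior_set (X \<inter> measurement_set c V y)"
    by (simp add: prior_set_def)
qed

lemma return_in_updated_set:
  fixes c :: "'a::topological_space \<Rightarrow> 'b::{real_normed_vector, second_countable_topology}"
  assumes c: "c \<in> borel_measurable borel" and V: "V \<in> sets borel"
    and X: "X \<in> sets borel" and x0: "x\<^sub>0 \<in> X" "x\<^sub>0 \<in> measurement_set c V y"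
  shows "return borel x\<^sub>0 \<in> updated_set c V X y"
proof -
  \<comment> \<open>The noise constraint binds the kernel at every \<open>x\<close>, not only at
    \<open>x\<^sub>0\<close>. Where \<open>y\<close> is unreachable, \<open>h\<close> falls back on
    the noise value \<open>v\<close> that explains \<open>y\<close> at \<open>x\<^sub>0\<close>. One
    fixed \<open>v\<close> for all such \<open>x\<close> keeps \<open>h\<close> Borel.\<close>
  define v where "v = y - c x\<^sub>0"
  define h where "h x = (if y - c x \<in> V then y else c x + v)" for x
  define L where "L x = return borel (h x)" for x
  have v: "v \<in> V" using x0 by (simp add: v_def measurement_set_def)
  have "h \<in> borel_measurable borel"
    unfolding h_def using c V by measurable
  then have Lm: "L \<in> borel \<rightarrow>\<^sub>M prob_algebra borel"
    unfolding L_def by (rule measurable_compose[OF _ measurable_return_prob_space])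
  have "emeasure (L x) ((\<lambda>v. c x + v) ` V) = 1" for x
  proof -
    \<comment> \<open>Borel images of Borel sets need not be Borel, so the translate is rewritten as
      a preimage under the inverse translation.\<close>
    have "(\<lambda>v. c x + v) ` V = (\<lambda>z. z - c x) -` V"
      by (auto simp: image_iff algebra_simps intro!: bexI[of _ "_ - c x"])
    also have "\<dots> \<in> sets borel"
      using measurable_sets_borel[OF _ V, of "\<lambda>z. z - c x"] by simp
    finally have "(\<lambda>v. c x + v) ` V \<in> sets borel" .
    moreover have "h x \<in> (\<lambda>v. c x + v) ` V"
      using v by (auto simp: h_def image_iff intro!: bexI[of _ "y - c x"])
    ultimately show ?thesis by (simp add: L_def)
  qed
  with Lm have L: "L \<in> noise_kernels c V" by (simp add: noise_kernels_def)
  have Q: "return borel x\<^sub>0 \<in> prior_set X"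
    using x0 X by (auto simp: prior_set_def intro!: prob_space_return)
  have Lx0: "emeasure (L x\<^sub>0) {y} = 1"
    using x0 by (simp add: L_def h_def measurement_set_def)
  have [measurable]: "(\<lambda>x. emeasure (L x) {y}) \<in> borel_measurable borel"
    by (rule measurable_emeasure_kernel[OF measurable_prob_algebraD[OF Lm]]) auto
  have int: "(\<integral>\<^sup>+x. emeasure (L x) {y} \<partial>return borel x\<^sub>0) = 1"
    by (subst nn_integral_return) (auto simp: Lx0)
  have "bayes_update L (return borel x\<^sub>0) y = return borel x\<^sub>0"
  proof (rule measure_eqI)
    show "sets (bayes_update L (return borel x\<^sub>0) y) = sets (return borel x\<^sub>0)"
      using sets_bayes_update[OF Lm, of "return borel x\<^sub>0"] by simp
    fix A assume "A \<in> sets (bayes_update L (return borel x\<^sub>0) y)"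
    then have A[measurable]: "A \<in> sets borel"
      using sets_bayes_update[OF Lm, of "return borel x\<^sub>0"] by simp
    have "(\<integral>\<^sup>+x\<in>A. emeasure (L x) {y} \<partial>return borel x\<^sub>0) = indicator A x\<^sub>0"
      by (subst nn_integral_return) (auto simp: Lx0)
    then show "emeasure (bayes_update L (return borel x\<^sub>0) y) A = emeasure (return borel x\<^sub>0) A"
      using emeasure_bayes_update[OF Lm _ A, of "return borel x\<^sub>0"] int A
      by (simp add: divide_ennreal_def)
  qed
  then show ?thesis
    unfolding updated_set_def using L Q int
    by (auto intro!: exI[of _ L] exI[of _ "return borel x\<^sub>0"])
qed

text \<open>The updated set is squeezed between the Dirac measures on the intersection and all
  probability measures supported there; every such family has the same suprema. If the intersection
  is empty, so is the updated set, and both suprema are -\<infinity>.\<close>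

lemma updated_set_equiv:
  fixes c :: "'a::topological_space \<Rightarrow> 'b::{real_normed_vector, second_countable_topology}"
  assumes c: "c \<in> borel_measurable borel" and V: "V \<in> sets borel" and X: "X \<in> sets borel"
  shows "inference_equiv (updated_set c V X y)
           (measure_convex_hull ((\<lambda>x. return borel x) ` (X \<inter> measurement_set c V y)))"
proof -
  let ?X = "X \<inter> measurement_set c V y"
  have "measurement_set c V y = (\<lambda>x. y - c x) -` V"
    by (auto simp: measurement_set_def)
  also have "\<dots> \<in> sets borel"
    using measurable_sets_borel[OF _ V, of "\<lambda>x. y - c x"] c by simp
  finally have Y: "measurement_set c V y \<in> sets borel" .
  with X have XY: "?X \<in> sets borel" by simp
  have supp: "sets P = sets borel \<and> prob_space P \<and> (AE x in P. x \<in> ?X)"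
    if "P \<in> prior_set ?X" for P
    using prior_setD[OF that XY] by simp
  have sub: "updated_set c V X y \<subseteq> prior_set ?X"
    by (rule updated_set_subset_prior_set[OF X Y])
  have dirac: "return borel x \<in> updated_set c V X y" if "x \<in> ?X" for x
    using that by (intro return_in_updated_set c V X) auto
  show ?thesis
    unfolding inference_equiv_def
  proof (intro allI impI)
    fix g :: "'a \<Rightarrow> real"
    assume g: "g \<in> borel_measurable borel \<and> bounded (range g)"
    have "(SUP P\<in>updated_set c V X y. ereal (integral\<^sup>L P g)) = (SUP x\<in>?X. ereal (g x))"
      using g sub by (intro SUP_integral_supported supp dirac) auto
    \<comment> \<open>The Dirac measures belong to this prior set because they are updated measures
      and \<open>sub\<close> applies.\<close>
    also have "\<dots> = (SUP P\<in>prior_set ?X. ereal (integral\<^sup>L P g))"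
      using g sub dirac by (intro SUP_integral_supported[symmetric] supp) auto
    also have "\<dots> = (SUP P\<in>measure_convex_hull ((\<lambda>x. return borel x) ` ?X).
        ereal (integral\<^sup>L P g))"
      using prior_set_equiv[OF XY] g by (simp add: inference_equiv_def)
    finally show "(SUP P\<in>updated_set c V X y. ereal (integral\<^sup>L P g)) =
      (SUP P\<in>measure_convex_hull ((\<lambda>x. return borel x) ` ?X). ereal (integral\<^sup>L P g))" .
  qed
qed

lemma poly_map_deg_le_borel_measurable:
  fixes f :: "real^'n \<Rightarrow> real^'m"
  assumes "poly_map_deg_le d f"
  shows "f \<in> borel_measurable borel"
proof (rule borel_measurable_continuous_onI)
  have "continuous_on UNIV (\<lambda>x. f x $ j)" for j
    using assms
    by (auto simp: poly_map_deg_le_def continuous_on_eq_continuous_within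
        intro: continuous_real_polymonial_function real_poly_deg_le_imp_real_polynomial_function)
  then have "continuous_on UNIV (\<lambda>x. \<chi> j. f x $ j)"
    by (rule continuous_on_vec_lambda)
  then show "continuous_on UNIV f" by simp
qed

theorem theorem2:
  fixes a :: "nat \<Rightarrow> real^'n \<Rightarrow> real^'n"
    and c :: "nat \<Rightarrow> real^'n \<Rightarrow> real^'m"
    and X W :: "nat \<Rightarrow> (real^'n) set"
    and V :: "nat \<Rightarrow> (real^'m) set"
    and y :: "nat \<Rightarrow> real^'m"
    and d k :: nat
  assumes "k \<ge> 1"
    and "poly_map_deg_le d (a (k - 1))"
    and "poly_map_deg_le d (c k)"
    and "compact (V k)" and "basic_semialgebraic (V k)"
    and "X (k - 1) \<in> sets borel"
    and "compact (W (k - 1))" and "basic_semialgebraic (W (k - 1))"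
    and "predicted_support (a (k - 1)) (X (k - 1)) (W (k - 1)) \<in> sets borel"
    and "X k = predicted_support (a (k - 1)) (X (k - 1)) (W (k - 1))
           \<inter> measurement_set (c k) (V k) (y k)"
  shows "inference_equiv
           (updated_set (c k) (V k)
              (predicted_support (a (k - 1)) (X (k - 1)) (W (k - 1))) (y k))
           (measure_convex_hull ((\<lambda>x. return borel x) ` X k))"
  \<comment> \<open>Three Borel conditions remain: \<open>c k\<close> is measurable as a polynomial
    map, \<open>V k\<close> is Borel by compactness, and the predicted support is Borel by
    assumption.\<close>
  unfolding assms(10)
  by (intro updated_set_equiv poly_map_deg_le_borel_measurable[OF assms(3)] assms(9)
      borel_compact assms(4))

end
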